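(* (Buttress Lemma.) Let $\lambda$ be an infinite cardinal, let $\mathcal{B}$ and $\mathcal{S}$ be categories together with a full subcategory $\mathcal{B}^\dagger$ of $\mathcal{B}$, a subcategory $\mathcal{S}^{\Rightarrow}$ of $\mathcal{S}$ (whose arrows are called double arrows and written $\Rightarrow$), and a functor $\Psi\colon\mathcal{B}\to\mathcal{S}$. Let $U$ be a lower $\lambda$-small poset, let $B$ be an object of $\mathcal{B}$, and let $\overrightarrow{\rho}=(\rho_u\colon\Psi(B)\Rightarrow S_u\mid u\in U)$ be a $U$-indexed family of morphisms in $\mathcal{S}^{\Rightarrow}$. Assume: $(\mathrm{LS}^{\mathrm b}_\lambda(B))$ For each $u\in U$, each double arrow $\psi\colon\Psi(B)\Rightarrow S_u$, each $\lambda$-small set $I$, and each family $(\gamma_i\colon C_i\rightarrowtail B\mid i\in I)$ of monic objects in $\mathcal{B}^\dagger\downarrow B$, there exists a monic object $\gamma\colon C\rightarrowtail B$ in $\mathcal{B}^\dagger\downarrow B$ such that $\gamma_i\trianglelefteq\gamma$ for each $i\in I$ while $\psi\circ\Psi(\gamma)$ is a morphism of $\mathcal{S}^{\Rightarrow}$. Assume furthermore that either $U$ is well-founded or the following three conditions hold: (1) every diagram in $\mathcal{B}^\dagger$ indexed by a nonempty directed $\lambda$-small poset has a colimit in $\mathcal{B}$ whose underlying object belongs to $\mathcal{B}^\dagger$; (2) $\mathcal{S}^{\Rightarrow}$ is right closed under all $\lambda$-small directed colimits; (3) $\Psi$ preserves all $\lambda$-small directed colimits. Then $\overrightarrow{\rho}$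 has a buttress.
   Context: A set is $\lambda$-small if its cardinality is $<\lambda$. A poset $U$ is lower $\lambda$-small if $\{v\in U\mid v\le u\}$ is $\lambda$-small for each $u\in U$; well-founded if each nonempty subset has a minimal element. All posets are nonempty. Objects of the comma category $\mathcal{B}^\dagger\downarrow B$ are morphisms $\gamma\colon C\to B$ of $\mathcal{B}$ with $C$ in $\mathcal{B}^\dagger$; a morphism from $\gamma\colon C\to B$ to $\gamma'\colon C'\to B$ is a morphism $f\colon C\to C'$ with $\gamma'\circ f=\gamma$; $\gamma\trianglelefteq\gamma'$ means that such an $f$ exists. A "monic object" of $\mathcal{B}^\dagger\downarrow B$ is one that is a monomorphism in $\mathcal{B}$. "$\mathcal{S}^{\Rightarrow}$ is right closed under $\lambda$-small directed colimits" means: for every colimit cocone $(S,s_i\mid i\in I)$ in $\mathcal{S}$ of a diagram indexed by a $\lambda$-small directed poset $I$, and every morphism $f\colon S\to T$ in $\mathcal{S}$, if $f\circ s_i$ is a morphism of $\mathcal{S}^{\Rightarrow}$ for each $i\in I$, then so is $f$. A *buttress* of a family $(\rho_u\colon\Psi(B)\to S_u\mid u\in U)$ of morphisms in $\mathcal{S}$ is a $U$-indexed diagram $(\beta_u\colon B_u\to B,\ \beta_u^v\colon\beta_u\to\beta_v\mid u\le v\text{ in }U)$ in $\mathcal{B}^\dagger\downarrow B$ such that $\rho_u\circ\Psi(\beta_u)$ is a morphism of $\mathcal{S}^{\Rightarrow}$ for each $u\in U$. *)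

theory Defs
  imports Main
begin

unbundle cardinal_syntax

section \<open>Categories, subcategories, functors\<close>

text \<open>Composition is written in the usual order: \<open>g \<cdot>\<^bsub>C\<^esub> f\<close> is ``first \<open>f\<close>, then \<open>g\<close>''.
  The operations are only meaningful on the objects and arrows of the category.\<close>

record ('o, 'a) category =
  Ob :: "'o set"
  Ar :: "'a set"
  Dom :: "'a \<Rightarrow> 'o"
  Cod :: "'a \<Rightarrow> 'o"
  Idt :: "'o \<Rightarrow> 'a"
  Cmp :: "'a \<Rightarrow> 'a \<Rightarrow> 'a" (infixr "\<cdot>\<index>" 70)

definition Hom :: "('o, 'a, 'm) category_scheme \<Rightarrow> 'o \<Rightarrow> 'o \<Rightarrow> 'a set" where
  "Hom C a b = {f \<in> Ar C. Dom C f = a \<and> Cod C f = b}"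

locale category =
  fixes C :: "('o, 'a, 'm) category_scheme" (structure)
  assumes Dom_closed: "f \<in> Ar C \<Longrightarrow> Dom C f \<in> Ob C"
    and Cod_closed: "f \<in> Ar C \<Longrightarrow> Cod C f \<in> Ob C"
    and Idt_closed: "a \<in> Ob C \<Longrightarrow> Idt C a \<in> Hom C a a"
    and Cmp_closed: "f \<in> Hom C a b \<Longrightarrow> g \<in> Hom C b c \<Longrightarrow> g \<cdot> f \<in> Hom C a c"
    and Cmp_Idt: "f \<in> Hom C a b \<Longrightarrow> f \<cdot> Idt C a = f"
    and Idt_Cmp: "f \<in> Hom C a b \<Longrightarrow> Idt C b \<cdot> f = f"
    and Cmp_assoc: "f \<in> Hom C a b \<Longrightarrow> g \<in> Hom C b c \<Longrightarrow> h \<in> Hom C c d \<Longrightarrow>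
      (h \<cdot> g) \<cdot> f = h \<cdot> (g \<cdot> f)"

definition monic :: "('o, 'a, 'm) category_scheme \<Rightarrow> 'a \<Rightarrow> bool" where
  "monic C m \<longleftrightarrow> m \<in> Ar C \<and>
     (\<forall>a. \<forall>f \<in> Hom C a (Dom C m). \<forall>g \<in> Hom C a (Dom C m).
        m \<cdot>\<^bsub>C\<^esub> f = m \<cdot>\<^bsub>C\<^esub> g \<longrightarrow> f = g)"

definition subcategory ::
    "('o, 'a, 'm) category_scheme \<Rightarrow> ('o, 'a, 'n) category_scheme \<Rightarrow> bool" where
  "subcategory D C \<longleftrightarrow> category D \<and> category C \<and> Ob D \<subseteq> Ob C \<and> Ar D \<subseteq> Ar C \<and>
     (\<forall>f \<in> Ar D. Dom D f = Dom C f \<and> Cod D f = Cod C f) \<and>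
     (\<forall>a \<in> Ob D. Idt D a = Idt C a) \<and>
     (\<forall>f \<in> Ar D. \<forall>g \<in> Ar D. Cod D f = Dom D g \<longrightarrow> g \<cdot>\<^bsub>D\<^esub> f = g \<cdot>\<^bsub>C\<^esub> f)"

definition full_subcategory ::
    "('o, 'a, 'm) category_scheme \<Rightarrow> ('o, 'a, 'n) category_scheme \<Rightarrow> bool" where
  "full_subcategory D C \<longleftrightarrow> subcategory D C \<and>
     (\<forall>a \<in> Ob D. \<forall>b \<in> Ob D. Hom C a b \<subseteq> Ar D)"

locale cat_functor = source: category C + target: category D
  for C :: "('o, 'a, 'm) category_scheme" and D :: "('p, 'b, 'n) category_scheme" +
  fixes Fo :: "'o \<Rightarrow> 'p" and Fa :: "'a \<Rightarrow> 'b"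
  assumes Fo_closed: "a \<in> Ob C \<Longrightarrow> Fo a \<in> Ob D"
    and Fa_closed: "f \<in> Hom C a b \<Longrightarrow> Fa f \<in> Hom D (Fo a) (Fo b)"
    and Fa_Idt: "a \<in> Ob C \<Longrightarrow> Fa (Idt C a) = Idt D (Fo a)"
    and Fa_Cmp: "f \<in> Hom C a b \<Longrightarrow> g \<in> Hom C b c \<Longrightarrow>
      Fa (g \<cdot>\<^bsub>C\<^esub> f) = Fa g \<cdot>\<^bsub>D\<^esub> Fa f"

section \<open>The comma category\<close>

text \<open>For a full subcategory \<open>D\<close> of \<open>C\<close> and an object \<open>b\<close> of \<open>C\<close>. An arrow is a triple
  \<open>(\<gamma>, f, \<gamma>')\<close>, so that it determines its domain and codomain.\<close>

definition comma ::
    "('o, 'a, 'm) category_scheme \<Rightarrow> ('o, 'a, 'n) category_scheme \<Rightarrow> 'o \<Rightarrow>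
     ('a, 'a \<times> 'a \<times> 'a) category" where
  "comma D C b =
     \<lparr> Ob = {\<gamma> \<in> Ar C. Dom C \<gamma> \<in> Ob D \<and> Cod C \<gamma> = b},
       Ar = {(\<gamma>, f, \<gamma>'). \<gamma> \<in> Ar C \<and> Dom C \<gamma> \<in> Ob D \<and> Cod C \<gamma> = b \<and>
                         \<gamma>' \<in> Ar C \<and> Dom C \<gamma>' \<in> Ob D \<and> Cod C \<gamma>' = b \<and>
                         f \<in> Hom C (Dom C \<gamma>) (Dom C \<gamma>') \<and> \<gamma>' \<cdot>\<^bsub>C\<^esub> f = \<gamma>},
       Dom = (\<lambda>(\<gamma>, f, \<gamma>'). \<gamma>),
       Cod = (\<lambda>(\<gamma>, f, \<gamma>'). \<gamma>'),
       Idt = (\<lambda>\<gamma>. (\<gamma>, Idt C (Dom C \<gamma>), \<gamma>)),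
       Cmp = (\<lambda>(\<gamma>', g, \<gamma>'') (\<gamma>, f, \<gamma>'). (\<gamma>, g \<cdot>\<^bsub>C\<^esub> f, \<gamma>'')) \<rparr>"

lemma category_comma:
  assumes "category C"
  shows "category (comma D C b)"
proof -
  interpret category C by fact
  have Cmp': "g \<cdot>\<^bsub>C\<^esub> f \<in> Ar C \<and> Dom C (g \<cdot>\<^bsub>C\<^esub> f) = Dom C f \<and> Cod C (g \<cdot>\<^bsub>C\<^esub> f) = Cod C g"
    if "f \<in> Ar C" "g \<in> Ar C" "Cod C f = Dom C g" for f g
    using Cmp_closed[of f "Dom C f" "Cod C f" g "Cod C g"] that by (simp add: Hom_def)
  have assoc': "(h \<cdot>\<^bsub>C\<^esub> g) \<cdot>\<^bsub>C\<^esub> f = h \<cdot>\<^bsub>C\<^esub> (g \<cdot>\<^bsub>C\<^esub> f)"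
    if "f \<in> Ar C" "g \<in> Ar C" "h \<in> Ar C" "Cod C f = Dom C g" "Cod C g = Dom C h" for f g h
    using Cmp_assoc[of f "Dom C f" "Cod C f" g "Cod C g" h "Cod C h"] that by (simp add: Hom_def)
  have Idt': "Idt C a \<in> Ar C \<and> Dom C (Idt C a) = a \<and> Cod C (Idt C a) = a" if "a \<in> Ob C" for a
    using Idt_closed[OF that] by (simp add: Hom_def)
  have right': "f \<cdot>\<^bsub>C\<^esub> Idt C (Dom C f) = f" if "f \<in> Ar C" for f
    using Cmp_Idt[of f "Dom C f" "Cod C f"] that by (simp add: Hom_def)
  have left': "Idt C (Cod C f) \<cdot>\<^bsub>C\<^esub> f = f" if "f \<in> Ar C" for f
    using Idt_Cmp[of f "Dom C f" "Cod C f"] that by (simp add: Hom_def)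
  show ?thesis
  proof
    fix f a b' g c
    assume *: "f \<in> Hom (comma D C b) a b'" "g \<in> Hom (comma D C b) b' c"
    obtain f' where f: "f = (a, f', b')" using *(1) by (cases f) (auto simp: comma_def Hom_def)
    obtain g' where g: "g = (b', g', c)" using *(2) by (cases g) (auto simp: comma_def Hom_def)
    have "c \<cdot>\<^bsub>C\<^esub> (g' \<cdot>\<^bsub>C\<^esub> f') = a"
      using * assoc'[of f' g' c] by (simp add: f g comma_def Hom_def)
    then show "g \<cdot>\<^bsub>comma D C b\<^esub> f \<in> Hom (comma D C b) a c"
      using * Cmp'[of f' g'] by (simp add: f g comma_def Hom_def)
  next
    fix f a b' g c h d
    assume *: "f \<in> Hom (comma D C b) a b'" "g \<in> Hom (comma D C b) b' c"
      "h \<in> Hom (comma D C b) c d"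
    obtain f' where f: "f = (a, f', b')" using *(1) by (cases f) (auto simp: comma_def Hom_def)
    obtain g' where g: "g = (b', g', c)" using *(2) by (cases g) (auto simp: comma_def Hom_def)
    obtain h' where h: "h = (c, h', d)" using *(3) by (cases h) (auto simp: comma_def Hom_def)
    show "(h \<cdot>\<^bsub>comma D C b\<^esub> g) \<cdot>\<^bsub>comma D C b\<^esub> f
        = h \<cdot>\<^bsub>comma D C b\<^esub> (g \<cdot>\<^bsub>comma D C b\<^esub> f)"
      using * assoc'[of f' g' h'] by (simp add: f g h comma_def Hom_def)
  next
    fix a assume "a \<in> Ob (comma D C b)"
    then show "Idt (comma D C b) a \<in> Hom (comma D C b) a a"
      using Idt'[OF Dom_closed, of a] right'[of a] by (simp add: comma_def Hom_def)
  next
    fix f a b' assume *: "f \<in> Hom (comma D C b) a b'"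
    obtain f' where f: "f = (a, f', b')" using * by (cases f) (auto simp: comma_def Hom_def)
    show "f \<cdot>\<^bsub>comma D C b\<^esub> Idt (comma D C b) a = f"
      using * right'[of f'] by (simp add: f comma_def Hom_def)
    show "Idt (comma D C b) b' \<cdot>\<^bsub>comma D C b\<^esub> f = f"
      using * left'[of f'] by (simp add: f comma_def Hom_def)
  next
    fix f assume "f \<in> Ar (comma D C b)"
    then show "Dom (comma D C b) f \<in> Ob (comma D C b)" "Cod (comma D C b) f \<in> Ob (comma D C b)"
      by (cases f; simp add: comma_def)+
  qed
qed

definition trianglelefteq ::
    "('o, 'a, 'm) category_scheme \<Rightarrow> ('o, 'a, 'n) category_scheme \<Rightarrow> 'o \<Rightarrow> 'a \<Rightarrow> 'a \<Rightarrow> bool" where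
  "trianglelefteq D C b \<gamma> \<gamma>' \<longleftrightarrow> Hom (comma D C b) \<gamma> \<gamma>' \<noteq> {}"

definition monic_object ::
    "('o, 'a, 'm) category_scheme \<Rightarrow> ('o, 'a, 'n) category_scheme \<Rightarrow> 'o \<Rightarrow> 'a \<Rightarrow> bool" where
  "monic_object D C b \<gamma> \<longleftrightarrow> \<gamma> \<in> Ob (comma D C b) \<and> monic C \<gamma>"

section \<open>Posets and smallness\<close>

text \<open>A poset is a nonempty carrier \<open>U\<close> with a relation \<open>le \<subseteq> U \<times> U\<close>; \<open>(u, v) \<in> le\<close>
  means \<open>u \<le> v\<close>.\<close>

definition poset :: "'u set \<Rightarrow> 'u rel \<Rightarrow> bool" where
  "poset U le \<longleftrightarrow> U \<noteq> {} \<and> partial_order_on U le"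

definition directed_poset :: "'u set \<Rightarrow> 'u rel \<Rightarrow> bool" where
  "directed_poset U le \<longleftrightarrow> poset U le \<and>
     (\<forall>u \<in> U. \<forall>v \<in> U. \<exists>w \<in> U. (u, w) \<in> le \<and> (v, w) \<in> le)"

definition well_founded_poset :: "'u set \<Rightarrow> 'u rel \<Rightarrow> bool" where
  "well_founded_poset U le \<longleftrightarrow> poset U le \<and>
     (\<forall>X \<subseteq> U. X \<noteq> {} \<longrightarrow> (\<exists>m \<in> X. \<forall>x \<in> X. (x, m) \<in> le \<longrightarrow> x = m))"

text \<open>A cardinal is represented, as in the library, by a relation \<open>lam\<close> with
  \<open>Card_order lam\<close>.\<close>

definition small :: "'k rel \<Rightarrow> 'x set \<Rightarrow> bool" where
  "small lam X \<longleftrightarrow> |X| <o lam"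

definition lower_small :: "'k rel \<Rightarrow> 'u set \<Rightarrow> 'u rel \<Rightarrow> bool" where
  "lower_small lam U le \<longleftrightarrow> (\<forall>u \<in> U. small lam {v \<in> U. (v, u) \<in> le})"

section \<open>Poset-indexed diagrams and their colimits\<close>

definition diagram ::
    "'i set \<Rightarrow> 'i rel \<Rightarrow> ('o, 'a, 'm) category_scheme \<Rightarrow> ('i \<Rightarrow> 'o) \<Rightarrow> ('i \<Rightarrow> 'i \<Rightarrow> 'a) \<Rightarrow> bool" where
  "diagram I le C X t \<longleftrightarrow>
     (\<forall>i \<in> I. X i \<in> Ob C) \<and>
     (\<forall>i j. (i, j) \<in> le \<longrightarrow> t i j \<in> Hom C (X i) (X j)) \<and>
     (\<forall>i \<in> I. t i i = Idt C (X i)) \<and>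
     (\<forall>i j k. (i, j) \<in> le \<longrightarrow> (j, k) \<in> le \<longrightarrow> t j k \<cdot>\<^bsub>C\<^esub> t i j = t i k)"

definition cocone ::
    "'i set \<Rightarrow> 'i rel \<Rightarrow> ('o, 'a, 'm) category_scheme \<Rightarrow> ('i \<Rightarrow> 'o) \<Rightarrow> ('i \<Rightarrow> 'i \<Rightarrow> 'a) \<Rightarrow>
     'o \<Rightarrow> ('i \<Rightarrow> 'a) \<Rightarrow> bool" where
  "cocone I le C X t c s \<longleftrightarrow>
     c \<in> Ob C \<and>
     (\<forall>i \<in> I. s i \<in> Hom C (X i) c) \<and>
     (\<forall>i j. (i, j) \<in> le \<longrightarrow> s j \<cdot>\<^bsub>C\<^esub> t i j = s i)"

definition colimit_cocone ::
    "'i set \<Rightarrow> 'i rel \<Rightarrow> ('o, 'a, 'm) category_scheme \<Rightarrow> ('i \<Rightarrow> 'o) \<Rightarrow> ('i \<Rightarrow> 'i \<Rightarrow> 'a) \<Rightarrow>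
     'o \<Rightarrow> ('i \<Rightarrow> 'a) \<Rightarrow> bool" where
  "colimit_cocone I le C X t c s \<longleftrightarrow>
     cocone I le C X t c s \<and>
     (\<forall>c' s'. cocone I le C X t c' s' \<longrightarrow>
        (\<exists>!h. h \<in> Hom C c c' \<and> (\<forall>i \<in> I. h \<cdot>\<^bsub>C\<^esub> s i = s' i)))"

text \<open>In the following definitions the \<open>lam\<close>-small index sets range over the subsets of the
  type \<open>'k\<close> underlying \<open>lam\<close>. This is no restriction: every set of cardinality less than
  \<open>lam\<close>, of whatever type, is in bijection with a subset of \<open>Field lam\<close>.\<close>

definition has_small_directed_colimits_in ::
    "'k rel \<Rightarrow> ('o, 'a, 'm) category_scheme \<Rightarrow> ('o, 'a, 'n) category_scheme \<Rightarrow> bool" where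
  "has_small_directed_colimits_in lam D C \<longleftrightarrow>
     (\<forall>(I :: 'k set) le X t.
        directed_poset I le \<longrightarrow> small lam I \<longrightarrow> diagram I le D X t \<longrightarrow>
        (\<exists>c s. colimit_cocone I le C X t c s \<and> c \<in> Ob D))"

definition right_closed_small_directed_colimits ::
    "'k rel \<Rightarrow> ('o, 'a, 'm) category_scheme \<Rightarrow> ('o, 'a, 'n) category_scheme \<Rightarrow> bool" where
  "right_closed_small_directed_colimits lam D C \<longleftrightarrow>
     (\<forall>(I :: 'k set) le X t c s.
        directed_poset I le \<longrightarrow> small lam I \<longrightarrow> diagram I le C X t \<longrightarrow>
        colimit_cocone I le C X t c s \<longrightarrow>
        (\<forall>d. \<forall>f \<in> Hom C c d. (\<forall>i \<in> I. f \<cdot>\<^bsub>C\<^esub> s i \<in> Ar D) \<longrightarrow> f \<in> Ar D))"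

definition preserves_small_directed_colimits ::
    "'k rel \<Rightarrow> ('o, 'a, 'm) category_scheme \<Rightarrow> ('p, 'b, 'n) category_scheme \<Rightarrow>
     ('o \<Rightarrow> 'p) \<Rightarrow> ('a \<Rightarrow> 'b) \<Rightarrow> bool" where
  "preserves_small_directed_colimits lam C D Fo Fa \<longleftrightarrow>
     (\<forall>(I :: 'k set) le X t c s.
        directed_poset I le \<longrightarrow> small lam I \<longrightarrow> diagram I le C X t \<longrightarrow>
        colimit_cocone I le C X t c s \<longrightarrow>
        colimit_cocone I le D (\<lambda>i. Fo (X i)) (\<lambda>i j. Fa (t i j)) (Fo c) (\<lambda>i. Fa (s i)))"

section \<open>The condition \<open>LS\<^sup>b\<close> and buttresses\<close>

text \<open>From here on \<open>\<B>d\<close> stands for the full subcategory \<open>\<B>\<^sup>\<dagger>\<close> of \<open>\<B>\<close>, \<open>\<S>d\<close> for the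
  subcategory \<open>\<S>\<^sup>\<Rightarrow>\<close> of double arrows of \<open>\<S>\<close>, and \<open>(\<Psi>o, \<Psi>a)\<close> for the object and arrow
  parts of the functor \<open>\<Psi>\<close>.\<close>

definition LSb ::
    "'k rel \<Rightarrow> ('o, 'a, 'm) category_scheme \<Rightarrow> ('o, 'a, 'n) category_scheme \<Rightarrow>
     ('p, 'b, 'r) category_scheme \<Rightarrow> ('p, 'b, 'q) category_scheme \<Rightarrow>
     ('o \<Rightarrow> 'p) \<Rightarrow> ('a \<Rightarrow> 'b) \<Rightarrow> 'u set \<Rightarrow> ('u \<Rightarrow> 'p) \<Rightarrow> 'o \<Rightarrow> bool" where
  "LSb lam \<B>d \<B> \<S>d \<S> \<Psi>o \<Psi>a U S B \<longleftrightarrow>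
     (\<forall>u \<in> U. \<forall>\<psi> \<in> Hom \<S>d (\<Psi>o B) (S u). \<forall>(I :: 'k set) (\<gamma>s :: 'k \<Rightarrow> 'a).
        small lam I \<longrightarrow> (\<forall>i \<in> I. monic_object \<B>d \<B> B (\<gamma>s i)) \<longrightarrow>
        (\<exists>\<gamma>. monic_object \<B>d \<B> B \<gamma> \<and>
             (\<forall>i \<in> I. trianglelefteq \<B>d \<B> B (\<gamma>s i) \<gamma>) \<and>
             \<psi> \<cdot>\<^bsub>\<S>\<^esub> \<Psi>a \<gamma> \<in> Ar \<S>d))"

definition buttress ::
    "('o, 'a, 'm) category_scheme \<Rightarrow> ('o, 'a, 'n) category_scheme \<Rightarrow>
     ('p, 'b, 'r) category_scheme \<Rightarrow> ('p, 'b, 'q) category_scheme \<Rightarrow>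
     ('a \<Rightarrow> 'b) \<Rightarrow> 'u set \<Rightarrow> 'u rel \<Rightarrow> 'o \<Rightarrow> ('u \<Rightarrow> 'b) \<Rightarrow>
     ('u \<Rightarrow> 'a) \<Rightarrow> ('u \<Rightarrow> 'u \<Rightarrow> 'a \<times> 'a \<times> 'a) \<Rightarrow> bool" where
  "buttress \<B>d \<B> \<S>d \<S> \<Psi>a U le B \<rho> \<beta> \<tau> \<longleftrightarrow>
     diagram U le (comma \<B>d \<B> B) \<beta> \<tau> \<and>
     (\<forall>u \<in> U. \<rho> u \<cdot>\<^bsub>\<S>\<^esub> \<Psi>a (\<beta> u) \<in> Ar \<S>d)"

end

theory Submission
  imports Defs
begin

text \<open>If \<open>U\<close> is well-founded, recursion along \<open>U\<close> yields monic objects \<open>\<gamma> u\<close> that increase with \<open>u\<close>;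
  arrows into a monic object are unique, so they form a diagram. For arbitrary \<open>U\<close> the
  recursion runs over the finite subsets of \<open>U\<close>, well-founded under inclusion, and \<open>\<beta> u\<close> is the
  colimit of the \<open>\<gamma> a\<close> over the finite sets \<open>a\<close> with greatest element \<open>u\<close>; the map
  \<open>a \<mapsto> insert v a\<close> induces the transition from \<open>\<beta> u\<close> to \<open>\<beta> v\<close>.\<close>

section \<open>Small sets\<close>

lemma small_subset:
  assumes "small lam X" and "Y \<subseteq> X"
  shows "small lam Y"
  using ordLeq_ordLess_trans[OF card_of_mono1[OF assms(2)]] assms(1) by (simp add: small_def)

lemma small_image:
  assumes "small lam X"
  shows "small lam (f ` X)"
  using ordLeq_ordLess_trans[OF card_of_image] assms by (auto simp: small_def)

lemma small_finite:
  assumes "Card_order lam" and "infinite (Field lam)" and "finite X"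
  shows "small lam X"
  using assms card_of_Well_order[of X] card_order_on_well_order_on[of "Field lam" lam]
  unfolding small_def by (intro finite_ordLess_infinite) (auto simp: Field_card_of)

text \<open>The colimit conditions and \<open>LSb\<close> quantify only over index sets inside the
  type \<open>'k\<close> of \<open>lam\<close>. Since \<open>lam\<close> is equinumerous with its
  field, a small \<open>X\<close> injects into \<open>Field lam\<close>, and \<open>K\<close> is the
  image.\<close>

lemma small_obtain_reindexing:
  fixes lam :: "'k rel"
  assumes "Card_order lam" and "small lam X"
  obtains K :: "'k set" and \<phi> where "bij_betw \<phi> K X" and "small lam K"
proof -
  have "|X| \<le>o |Field lam|"
    using ordLeq_ordIso_trans[OF ordLess_imp_ordLeq ordIso_symmetric[OF card_of_Field_ordIso]] assms
    by (auto simp: small_def)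
  then obtain g where g: "inj_on g X" "g ` X \<subseteq> Field lam"
    using card_of_ordLeq by metis
  then have "bij_betw (inv_into X g) (g ` X) X"
    by (intro bij_betw_inv_into) (simp add: bij_betw_def)
  then show thesis
    using that small_image[OF assms(2)] by blast
qed

text \<open>Stratify the finite subsets by size. A set of size \<open>Suc n\<close> is a point
  inserted into a set of size \<open>n\<close>, so each stratum is covered by a union over
  \<open>A\<close> of families of size at most \<open>|A|\<close>; there are countably many
  strata.\<close>

lemma card_of_Fpow_ordLeq:
  assumes "infinite A"
  shows "|Fpow A| \<le>o |A|"
proof -
  have "|{X. X \<subseteq> A \<and> finite X \<and> card X = n}| \<le>o |A|" for n
  proof (induction n)
    case 0
    have "{X. X \<subseteq> A \<and> finite X \<and> card X = 0} = {{}}" by auto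
    then show ?case using assms by (simp add: card_of_singl_ordLeq infinite_imp_nonempty)
  next
    case (Suc n)
    let ?F = "\<lambda>n. {X. X \<subseteq> A \<and> finite X \<and> card X = n}"
    have "?F (Suc n) \<subseteq> (\<Union>x\<in>A. insert x ` ?F n)"
    proof
      fix X assume X: "X \<in> ?F (Suc n)"
      then obtain x Y where "X = insert x Y" "x \<notin> Y" "card Y = n" "finite Y"
        by (auto simp: card_Suc_eq_finite)
      then show "X \<in> (\<Union>x\<in>A. insert x ` ?F n)" using X by auto
    qed
    moreover have "|insert x ` ?F n| \<le>o |A|" for x
      by (rule ordLeq_transitive[OF card_of_image Suc])
    then have "|\<Union>x\<in>A. insert x ` ?F n| \<le>o |A|" using assms
      by (intro card_of_UNION_ordLeq_infinite) (simp_all add: card_of_mono1)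
    ultimately show ?case using ordLeq_transitive[OF card_of_mono1] by fast
  qed
  then have "|\<Union>n\<in>(UNIV :: nat set). {X. X \<subseteq> A \<and> finite X \<and> card X = n}| \<le>o |A|"
    using assms by (intro card_of_UNION_ordLeq_infinite) (auto simp: infinite_iff_card_of_nat)
  moreover have "Fpow A = (\<Union>n\<in>(UNIV :: nat set). {X. X \<subseteq> A \<and> finite X \<and> card X = n})"
    by (auto simp: Fpow_def)
  ultimately show ?thesis by simp
qed

text \<open>Keeps the index posets of the later colimits small: they consist of finite subsets of
  lower sets. A finite \<open>X\<close> is treated apart, since the bound by \<open>|X|\<close> is
  available only for infinite sets.\<close>

lemma small_Fpow:
  assumes "Card_order lam" and "infinite (Field lam)" and "small lam X"
  shows "small lam (Fpow X)"
proof (cases "finite X")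
  case True
  then have "finite (Fpow X)" by (simp add: Fpow_Pow_finite)
  then show ?thesis using small_finite assms by blast
next
  case False
  then show ?thesis
    using ordLeq_ordLess_trans[OF card_of_Fpow_ordLeq] assms(3) by (simp add: small_def)
qed

section \<open>Reindexing diagrams\<close>

text \<open>\<open>\<phi>\<close> is total on its type, so membership in \<open>K\<close> is built
  into the relation; this keeps it inside \<open>K \<times> K\<close>, as \<open>poset\<close>
  demands.\<close>

definition pullback_rel :: "('k \<Rightarrow> 'i) \<Rightarrow> 'k set \<Rightarrow> 'i rel \<Rightarrow> 'k rel" where
  "pullback_rel \<phi> K le = {(k, l). k \<in> K \<and> l \<in> K \<and> (\<phi> k, \<phi> l) \<in> le}"

lemma poset_rel_subset: "poset U le \<Longrightarrow> le \<subseteq> U \<times> U"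
  by (simp add: poset_def partial_order_on_def preorder_on_def)

lemma posetD:
  assumes "poset U le"
  shows "\<And>u. u \<in> U \<Longrightarrow> (u, u) \<in> le"
    and "\<And>u v w. (u, v) \<in> le \<Longrightarrow> (v, w) \<in> le \<Longrightarrow> (u, w) \<in> le"
    and "\<And>u v. (u, v) \<in> le \<Longrightarrow> (v, u) \<in> le \<Longrightarrow> u = v"
    and "\<And>u v. (u, v) \<in> le \<Longrightarrow> u \<in> U"
    and "\<And>u v. (u, v) \<in> le \<Longrightarrow> v \<in> U"
  using assms
  by (auto simp: poset_def partial_order_on_def preorder_on_def refl_on_def
      dest: transD antisymD)

lemma directed_poset_pullback:
  assumes "bij_betw \<phi> K I" and "directed_poset I le"
  shows "directed_poset K (pullback_rel \<phi> K le)"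
proof -
  have po: "poset I le" using assms(2) by (simp add: directed_poset_def)
  have inj: "inj_on \<phi> K" and im: "\<phi> ` K = I" using assms(1) by (auto simp: bij_betw_def)
  have "poset K (pullback_rel \<phi> K le)"
    unfolding poset_def partial_order_on_def preorder_on_def
  proof (intro conjI)
    show "K \<noteq> {}" using po im by (auto simp: poset_def)
    show "pullback_rel \<phi> K le \<subseteq> K \<times> K" by (auto simp: pullback_rel_def)
    show "refl_on K (pullback_rel \<phi> K le)"
      using posetD(1)[OF po] im by (auto simp: pullback_rel_def refl_on_def)
    show "trans (pullback_rel \<phi> K le)"
      using posetD(2)[OF po] by (auto simp: pullback_rel_def trans_def)
    show "antisym (pullback_rel \<phi> K le)"
      using posetD(3)[OF po] inj by (auto simp: pullback_rel_def antisym_def inj_on_def)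
  qed
  moreover have "\<exists>m \<in> K. (k, m) \<in> pullback_rel \<phi> K le \<and> (l, m) \<in> pullback_rel \<phi> K le"
    if "k \<in> K" "l \<in> K" for k l
  proof -
    have "\<phi> k \<in> I" "\<phi> l \<in> I" using that im by auto
    then obtain w where "w \<in> I" "(\<phi> k, w) \<in> le" "(\<phi> l, w) \<in> le"
      using assms(2) unfolding directed_poset_def by blast
    moreover obtain m where "m \<in> K" "w = \<phi> m" using \<open>w \<in> I\<close> im by auto
    ultimately show ?thesis using that by (auto simp: pullback_rel_def)
  qed
  ultimately show ?thesis unfolding directed_poset_def by blast
qed

lemma diagram_pullback:
  assumes "bij_betw \<phi> K I" and "diagram I le C X t"
  shows "diagram K (pullback_rel \<phi> K le) C (\<lambda>k. X (\<phi> k)) (\<lambda>k l. t (\<phi> k) (\<phi> l))"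
  using assms by (auto simp: diagram_def pullback_rel_def dest: bij_betwE)

text \<open>\<open>s'\<close> has to agree with \<open>s \<circ> \<phi>\<close> on \<open>K\<close>
  only. This form serves both directions: legs over \<open>I\<close> composed with
  \<open>\<phi>\<close>, and legs over \<open>K\<close> read back through the inverse of
  \<open>\<phi>\<close>.\<close>

lemma cocone_pullback_iff:
  assumes bij: "bij_betw \<phi> K I" and le: "le \<subseteq> I \<times> I"
    and s: "\<And>k. k \<in> K \<Longrightarrow> s' k = s (\<phi> k)"
  shows "cocone K (pullback_rel \<phi> K le) C (\<lambda>k. X (\<phi> k)) (\<lambda>k l. t (\<phi> k) (\<phi> l)) c s'
    \<longleftrightarrow> cocone I le C X t c s"
proof -
  have im: "\<phi> ` K = I" using bij by (simp add: bij_betw_def)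
  have 1: "(\<forall>k \<in> K. s' k \<in> Hom C (X (\<phi> k)) c) \<longleftrightarrow> (\<forall>i \<in> I. s i \<in> Hom C (X i) c)"
    unfolding im[symmetric] by (simp add: s)
  have 2: "(\<forall>k l. (k, l) \<in> pullback_rel \<phi> K le \<longrightarrow> s' l \<cdot>\<^bsub>C\<^esub> t (\<phi> k) (\<phi> l) = s' k)
      \<longleftrightarrow> (\<forall>i j. (i, j) \<in> le \<longrightarrow> s j \<cdot>\<^bsub>C\<^esub> t i j = s i)" (is "?l \<longleftrightarrow> ?r")
  proof
    assume ?l
    show ?r
    proof (intro allI impI)
      fix i j assume ij: "(i, j) \<in> le"
      then have "i \<in> \<phi> ` K" "j \<in> \<phi> ` K" using le im by auto
      then obtain k l where "k \<in> K" "l \<in> K" "i = \<phi> k" "j = \<phi> l" by blast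
      then show "s j \<cdot>\<^bsub>C\<^esub> t i j = s i"
        using \<open>?l\<close>[rule_format, of k l] ij s by (simp add: pullback_rel_def)
    qed
  qed (simp add: pullback_rel_def s)
  show ?thesis unfolding cocone_def by (simp only: 1 2)
qed

text \<open>Cocones over \<open>K\<close> and over \<open>I\<close> with the same apex correspond
  through \<open>\<phi>\<close>, and the arrows mediating into them are the same, so the two
  universal properties agree.\<close>

lemma colimit_cocone_pullback_iff:
  assumes bij: "bij_betw \<phi> K I" and le: "le \<subseteq> I \<times> I"
    and s: "\<And>k. k \<in> K \<Longrightarrow> s' k = s (\<phi> k)"
  shows "colimit_cocone K (pullback_rel \<phi> K le) C (\<lambda>k. X (\<phi> k)) (\<lambda>k l. t (\<phi> k) (\<phi> l)) c s'
    \<longleftrightarrow> colimit_cocone I le C X t c s" (is "?L \<longleftrightarrow> ?R")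
proof -
  let ?coneK = "cocone K (pullback_rel \<phi> K le) C (\<lambda>k. X (\<phi> k)) (\<lambda>k l. t (\<phi> k) (\<phi> l))"
  let ?coneI = "cocone I le C X t"
  have im: "\<phi> ` K = I" using bij by (simp add: bij_betw_def)
  have med: "(\<forall>k \<in> K. h \<cdot>\<^bsub>C\<^esub> s' k = r' k) \<longleftrightarrow> (\<forall>i \<in> I. h \<cdot>\<^bsub>C\<^esub> s i = r i)"
    if "\<And>k. k \<in> K \<Longrightarrow> r' k = r (\<phi> k)" for h r r'
    unfolding im[symmetric] by (simp add: s that)
  have 1: "(\<forall>d r'. ?coneK d r' \<longrightarrow> (\<exists>!h. h \<in> Hom C c d \<and> (\<forall>k \<in> K. h \<cdot>\<^bsub>C\<^esub> s' k = r' k)))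
      \<longleftrightarrow> (\<forall>d r. ?coneI d r \<longrightarrow> (\<exists>!h. h \<in> Hom C c d \<and> (\<forall>i \<in> I. h \<cdot>\<^bsub>C\<^esub> s i = r i)))"
    (is "?l \<longleftrightarrow> ?r")
  proof
    assume l: ?l
    show ?r
    proof (intro allI impI)
      fix d r assume "?coneI d r"
      then have "?coneK d (\<lambda>k. r (\<phi> k))"
        using cocone_pullback_iff[OF bij le, where s = r and s' = "\<lambda>k. r (\<phi> k)" and X = X and t = t]
        by blast
      then have "\<exists>!h. h \<in> Hom C c d \<and> (\<forall>k \<in> K. h \<cdot>\<^bsub>C\<^esub> s' k = r (\<phi> k))" using l by blast
      then show "\<exists>!h. h \<in> Hom C c d \<and> (\<forall>i \<in> I. h \<cdot>\<^bsub>C\<^esub> s i = r i)"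
        by (simp only: med[of "\<lambda>k. r (\<phi> k)" r])
    qed
  next
    assume r: ?r
    show ?l
    proof (intro allI impI)
      fix d r' assume cone: "?coneK d r'"
      \<comment> \<open>Every cocone over \<open>K\<close> comes from one over \<open>I\<close>,
        with legs read through the inverse of \<open>\<phi>\<close>.\<close>
      define r where "r = (\<lambda>i. r' (inv_into K \<phi> i))"
      have r': "r' k = r (\<phi> k)" if "k \<in> K" for k
        using that bij by (simp add: r_def bij_betw_def)
      then have "?coneI d r"
        using cone cocone_pullback_iff[OF bij le, where s = r and s' = r' and X = X and t = t]
        by blast
      then have "\<exists>!h. h \<in> Hom C c d \<and> (\<forall>i \<in> I. h \<cdot>\<^bsub>C\<^esub> s i = r i)" using r by blast
      then show "\<exists>!h. h \<in> Hom C c d \<and> (\<forall>k \<in> K. h \<cdot>\<^bsub>C\<^esub> s' k = r' k)"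
        using med[of r' r, OF r'] by simp
    qed
  qed
  have 2: "?coneK c s' \<longleftrightarrow> ?coneI c s"
    using s by (rule cocone_pullback_iff[OF bij le])
  show ?thesis unfolding colimit_cocone_def by (simp only: 1 2)
qed

section \<open>The three colimit hypotheses for index posets of arbitrary type\<close>

lemma has_small_directed_colimits_inD:
  fixes lam :: "'k rel" and I :: "'i set"
  assumes "has_small_directed_colimits_in lam D C" and "Card_order lam"
    and "directed_poset I le" and "small lam I" and "diagram I le D X t"
  shows "\<exists>c s. colimit_cocone I le C X t c s \<and> c \<in> Ob D"
proof -
  obtain K :: "'k set" and \<phi> where bij: "bij_betw \<phi> K I" and K: "small lam K"
    using small_obtain_reindexing assms(2,4) by blast
  obtain c s where
    *: "colimit_cocone K (pullback_rel \<phi> K le) C (\<lambda>k. X (\<phi> k)) (\<lambda>k l. t (\<phi> k) (\<phi> l)) c s"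
    and "c \<in> Ob D"
    using assms(1) directed_poset_pullback[OF bij assms(3)] K diagram_pullback[OF bij assms(5)]
    unfolding has_small_directed_colimits_in_def by blast
  have "le \<subseteq> I \<times> I" using assms(3) by (auto simp: directed_poset_def dest: poset_rel_subset)
  \<comment> \<open>The legs over \<open>I\<close> are those over \<open>K\<close> taken at the
    inverse of \<open>\<phi>\<close>; on \<open>K\<close> this gives back the original
    \<open>s\<close>.\<close>
  moreover have "s k = s (inv_into K \<phi> (\<phi> k))" if "k \<in> K" for k
    using that bij by (simp add: bij_betw_def)
  ultimately have "colimit_cocone I le C X t c (\<lambda>i. s (inv_into K \<phi> i))"
    using * colimit_cocone_pullback_iff[OF bij, where s = "\<lambda>i. s (inv_into K \<phi> i)" and s' = s
        and X = X and t = t] by blast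
  then show ?thesis using \<open>c \<in> Ob D\<close> by blast
qed

lemma right_closed_small_directed_colimitsD:
  fixes lam :: "'k rel" and I :: "'i set"
  assumes "right_closed_small_directed_colimits lam D C" and "Card_order lam"
    and "directed_poset I le" and "small lam I" and "diagram I le C X t"
    and "colimit_cocone I le C X t c s"
    and "f \<in> Hom C c d" and "\<And>i. i \<in> I \<Longrightarrow> f \<cdot>\<^bsub>C\<^esub> s i \<in> Ar D"
  shows "f \<in> Ar D"
proof -
  obtain K :: "'k set" and \<phi> where bij: "bij_betw \<phi> K I" and K: "small lam K"
    using small_obtain_reindexing assms(2,4) by blast
  have "le \<subseteq> I \<times> I" using assms(3) by (auto simp: directed_poset_def dest: poset_rel_subset)
  then have "colimit_cocone K (pullback_rel \<phi> K le) C (\<lambda>k. X (\<phi> k)) (\<lambda>k l. t (\<phi> k) (\<phi> l)) c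
      (\<lambda>k. s (\<phi> k))"
    using assms(6) colimit_cocone_pullback_iff[OF bij, where s = s and s' = "\<lambda>k. s (\<phi> k)" and X = X and t = t]
    by blast
  moreover have "\<forall>k \<in> K. f \<cdot>\<^bsub>C\<^esub> s (\<phi> k) \<in> Ar D"
    using assms(8) bij by (auto dest: bij_betwE)
  ultimately show ?thesis
    using assms(1,7) directed_poset_pullback[OF bij assms(3)] K diagram_pullback[OF bij assms(5)]
    unfolding right_closed_small_directed_colimits_def by blast
qed

lemma preserves_small_directed_colimitsD:
  fixes lam :: "'k rel" and I :: "'i set"
  assumes "preserves_small_directed_colimits lam C D Fo Fa" and "Card_order lam"
    and "directed_poset I le" and "small lam I" and "diagram I le C X t"
    and "colimit_cocone I le C X t c s"
  shows "colimit_cocone I le D (\<lambda>i. Fo (X i)) (\<lambda>i j. Fa (t i j)) (Fo c) (\<lambda>i. Fa (s i))"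
proof -
  obtain K :: "'k set" and \<phi> where bij: "bij_betw \<phi> K I" and K: "small lam K"
    using small_obtain_reindexing assms(2,4) by blast
  have le: "le \<subseteq> I \<times> I" using assms(3) by (auto simp: directed_poset_def dest: poset_rel_subset)
  then have "colimit_cocone K (pullback_rel \<phi> K le) C (\<lambda>k. X (\<phi> k)) (\<lambda>k l. t (\<phi> k) (\<phi> l)) c
      (\<lambda>k. s (\<phi> k))"
    using assms(6) colimit_cocone_pullback_iff[OF bij, where s = s and s' = "\<lambda>k. s (\<phi> k)" and X = X and t = t]
    by blast
  then have "colimit_cocone K (pullback_rel \<phi> K le) D (\<lambda>k. Fo (X (\<phi> k)))
      (\<lambda>k l. Fa (t (\<phi> k) (\<phi> l))) (Fo c) (\<lambda>k. Fa (s (\<phi> k)))"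
    using assms(1) directed_poset_pullback[OF bij assms(3)] K diagram_pullback[OF bij assms(5)]
    unfolding preserves_small_directed_colimits_def by blast
  then show ?thesis
    using colimit_cocone_pullback_iff[OF bij le, where s = "\<lambda>i. Fa (s i)"
        and s' = "\<lambda>k. Fa (s (\<phi> k))" and X = "\<lambda>i. Fo (X i)" and t = "\<lambda>i j. Fa (t i j)"] by blast
qed

lemma cat_functor_diagram:
  assumes "cat_functor C D Fo Fa" and "le \<subseteq> I \<times> I" and "diagram I le C X t"
  shows "diagram I le D (\<lambda>i. Fo (X i)) (\<lambda>i j. Fa (t i j))"
proof -
  interpret cat_functor C D Fo Fa by fact
  show ?thesis
    unfolding diagram_def
  proof (intro conjI allI ballI impI)
    fix i j k assume "(i, j) \<in> le" "(j, k) \<in> le"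
    then show "Fa (t j k) \<cdot>\<^bsub>D\<^esub> Fa (t i j) = Fa (t i k)"
      using assms(3) Fa_Cmp[of "t i j" "X i" "X j" "t j k" "X k"] by (simp add: diagram_def)
  qed (use assms(3) Fo_closed Fa_closed Fa_Idt in \<open>auto simp: diagram_def\<close>)
qed

text \<open>The legs of a colimit are jointly epic: the composites \<open>h \<cdot> s i\<close> form
  a cocone to \<open>d\<close>, and both \<open>h\<close> and \<open>h'\<close> mediate into
  it.\<close>

lemma (in category) colimit_cocone_cancel:
  assumes colim: "colimit_cocone I le C X t c s" and dia: "diagram I le C X t"
    and le: "le \<subseteq> I \<times> I"
    and h: "h \<in> Hom C c d" and h': "h' \<in> Hom C c d"
    and eq: "\<And>i. i \<in> I \<Longrightarrow> h \<cdot> s i = h' \<cdot> s i"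
  shows "h = h'"
proof -
  have s: "s i \<in> Hom C (X i) c" if "i \<in> I" for i
    using colim that by (simp add: colimit_cocone_def cocone_def)
  have "cocone I le C X t d (\<lambda>i. h \<cdot> s i)"
    unfolding cocone_def
  proof (intro conjI ballI allI impI)
    show "d \<in> Ob C" using h Cod_closed by (auto simp: Hom_def)
    fix i assume "i \<in> I"
    then show "h \<cdot> s i \<in> Hom C (X i) d" using s h Cmp_closed by blast
  next
    fix i j assume ij: "(i, j) \<in> le"
    then have "j \<in> I" "t i j \<in> Hom C (X i) (X j)" "s j \<cdot> t i j = s i"
      using le dia colim by (auto simp: diagram_def colimit_cocone_def cocone_def)
    then show "(h \<cdot> s j) \<cdot> t i j = h \<cdot> s i"
      using Cmp_assoc[OF _ s h] by simp
  qed
  then have "\<exists>!k. k \<in> Hom C c d \<and> (\<forall>i \<in> I. k \<cdot> s i = h \<cdot> s i)"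
    using colim unfolding colimit_cocone_def by blast
  then show ?thesis using h h' eq by (metis (no_types, lifting))
qed

section \<open>Increasing families of monic objects\<close>

lemma subcategory_Hom:
  assumes "subcategory D C"
  shows "Hom D a b \<subseteq> Hom C a b"
  using assms by (auto simp: subcategory_def Hom_def)

lemma full_subcategory_Hom:
  assumes "full_subcategory D C" and "a \<in> Ob D" and "b \<in> Ob D"
  shows "Hom D a b = Hom C a b"
proof
  show "Hom D a b \<subseteq> Hom C a b"
    using assms(1) by (intro subcategory_Hom) (simp add: full_subcategory_def)
  have "Hom C a b \<subseteq> Ar D" "\<forall>f \<in> Ar D. Dom D f = Dom C f \<and> Cod D f = Cod C f"
    using assms by (simp_all add: full_subcategory_def subcategory_def)
  then show "Hom C a b \<subseteq> Hom D a b" unfolding Hom_def by blast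
qed

lemma Hom_comma_iff:
  "x \<in> Hom (comma D C b) \<gamma> \<gamma>' \<longleftrightarrow> (\<exists>f. x = (\<gamma>, f, \<gamma>') \<and>
     \<gamma> \<in> Ob (comma D C b) \<and> \<gamma>' \<in> Ob (comma D C b) \<and>
     f \<in> Hom C (Dom C \<gamma>) (Dom C \<gamma>') \<and> \<gamma>' \<cdot>\<^bsub>C\<^esub> f = \<gamma>)"
  by (cases x) (auto simp: comma_def Hom_def)

text \<open>The outer components of the triples are fixed, and the middle ones agree after
  composition with \<open>\<gamma>'\<close>, which can be cancelled.\<close>

lemma comma_Hom_monic_unique:
  assumes "monic_object D C b \<gamma>'"
    and "x \<in> Hom (comma D C b) \<gamma> \<gamma>'" and "y \<in> Hom (comma D C b) \<gamma> \<gamma>'"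
  shows "x = y"
  using assms unfolding Hom_comma_iff monic_object_def monic_def by metis

text \<open>Arrows may be chosen arbitrarily: uniqueness of arrows into monic objects forces the
  identity and composition laws. The relation is asked for distinct indices only, because the
  recursions below supply it along strict orders; identities fill the diagonal.\<close>

lemma increasing_monic_objects_diagram:
  assumes "category C" and "poset U le"
    and mon: "\<And>u. u \<in> U \<Longrightarrow> monic_object D C b (\<gamma> u)"
    and inc: "\<And>u v. (u, v) \<in> le \<Longrightarrow> u \<noteq> v \<Longrightarrow> trianglelefteq D C b (\<gamma> u) (\<gamma> v)"
  shows "\<exists>\<tau>. diagram U le (comma D C b) \<gamma> \<tau>"
proof -
  interpret comma: category "comma D C b" using assms(1) by (rule category_comma)
  note le = posetD[OF assms(2)]
  have ob: "\<gamma> u \<in> Ob (comma D C b)" if "u \<in> U" for u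
    using mon[OF that] by (simp add: monic_object_def)
  have "\<exists>x. x \<in> Hom (comma D C b) (\<gamma> u) (\<gamma> v)" if "(u, v) \<in> le" for u v
  proof (cases "u = v")
    case True
    then show ?thesis using comma.Idt_closed[OF ob[OF le(4)[OF that]]] by blast
  next
    case False
    then show ?thesis using inc[OF that] unfolding trianglelefteq_def by blast
  qed
  then obtain \<tau> where \<tau>: "\<And>u v. (u, v) \<in> le \<Longrightarrow> \<tau> u v \<in> Hom (comma D C b) (\<gamma> u) (\<gamma> v)"
    by metis
  have "diagram U le (comma D C b) \<gamma> \<tau>"
    unfolding diagram_def
  proof (intro conjI ballI allI impI)
    fix u assume u: "u \<in> U"
    then show "\<tau> u u = Idt (comma D C b) (\<gamma> u)"
      using comma_Hom_monic_unique[OF mon \<tau> comma.Idt_closed] ob le(1) by blast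
  next
    fix u v w assume *: "(u, v) \<in> le" "(v, w) \<in> le"
    then show "\<tau> v w \<cdot>\<^bsub>comma D C b\<^esub> \<tau> u v = \<tau> u w"
      using comma_Hom_monic_unique[OF mon comma.Cmp_closed \<tau>] \<tau> le(2,5) by blast
  qed (use ob \<tau> in auto)
  then show ?thesis by blast
qed

text \<open>Reindexing along a bijection from a subset of \<open>'k\<close> frees \<open>LSb\<close>
  from its index type.\<close>

lemma LSb_family:
  fixes lam :: "'k rel" and \<gamma>s :: "'i \<Rightarrow> 'a"
  assumes "LSb lam Bd B Sd S Fo Fa U T b" and "Card_order lam"
    and "u \<in> U" and "\<psi> \<in> Hom Sd (Fo b) (T u)" and "small lam I"
    and "\<And>i. i \<in> I \<Longrightarrow> monic_object Bd B b (\<gamma>s i)"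
  obtains \<gamma> where "monic_object Bd B b \<gamma>"
    and "\<And>i. i \<in> I \<Longrightarrow> trianglelefteq Bd B b (\<gamma>s i) \<gamma>"
    and "\<psi> \<cdot>\<^bsub>S\<^esub> Fa \<gamma> \<in> Ar Sd"
proof -
  obtain K :: "'k set" and \<phi> where bij: "bij_betw \<phi> K I" and K: "small lam K"
    using small_obtain_reindexing assms(2,5) by blast
  have im: "\<phi> ` K = I" using bij by (simp add: bij_betw_def)
  then have "\<forall>k \<in> K. monic_object Bd B b (\<gamma>s (\<phi> k))" using assms(6) by blast
  then obtain \<gamma> where "monic_object Bd B b \<gamma>" "\<psi> \<cdot>\<^bsub>S\<^esub> Fa \<gamma> \<in> Ar Sd"
    "\<forall>k \<in> K. trianglelefteq Bd B b (\<gamma>s (\<phi> k)) \<gamma>"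
    using assms(1)[unfolded LSb_def, rule_format, OF assms(3,4) K, of "\<lambda>k. \<gamma>s (\<phi> k)"] by blast
  then show thesis using that im by blast
qed

text \<open>Each object is only known to exist, so the recursion is a dependent choice along
  \<open>R\<close>. \<open>bound\<close> accepts any monic \<open>\<gamma>s\<close> on the
  predecessors of \<open>w\<close>, increasing or not; \<open>Q\<close> carries the extra demand at
  each stage, later the double arrow condition.\<close>

lemma wf_increasing_monic_objects:
  fixes C :: "('a, 'b, 'm) category_scheme" and W :: "'c set"
  assumes "wf R"
    and bound: "\<And>w \<gamma>s. w \<in> W \<Longrightarrow> (\<And>v. v \<in> W \<Longrightarrow> (v, w) \<in> R \<Longrightarrow> monic_object D C b (\<gamma>s v)) \<Longrightarrow>
      \<exists>\<gamma>. monic_object D C b \<gamma> \<and> Q w \<gamma> \<and>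
        (\<forall>v \<in> W. (v, w) \<in> R \<longrightarrow> trianglelefteq D C b (\<gamma>s v) \<gamma>)"
  obtains \<gamma> where "\<And>w. w \<in> W \<Longrightarrow> monic_object D C b (\<gamma> w)" and "\<And>w. w \<in> W \<Longrightarrow> Q w (\<gamma> w)"
    and "\<And>v w. v \<in> W \<Longrightarrow> w \<in> W \<Longrightarrow> (v, w) \<in> R \<Longrightarrow> trianglelefteq D C b (\<gamma> v) (\<gamma> w)"
proof -
  \<comment> \<open>\<open>dependent_wf_choice\<close> picks a value at every point of the type; the
    guard \<open>w \<in> W\<close> makes the demand vacuous outside \<open>W\<close>.\<close>
  define P where "P = (\<lambda>\<gamma>s w \<gamma>. w \<in> W \<longrightarrow> monic_object D C b \<gamma> \<and> Q w \<gamma> \<and>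
        (\<forall>v \<in> W. (v, w) \<in> R \<longrightarrow> trianglelefteq D C b (\<gamma>s v) \<gamma>))"
  have "\<exists>\<gamma>. \<forall>w. P \<gamma> w (\<gamma> w)"
    using \<open>wf R\<close>
  proof (rule dependent_wf_choice)
    fix \<gamma>s \<gamma>s' :: "'c \<Rightarrow> 'b" and w \<gamma> assume "\<And>v. (v, w) \<in> R \<Longrightarrow> \<gamma>s v = \<gamma>s' v"
    then show "P \<gamma>s w \<gamma> = P \<gamma>s' w \<gamma>" by (simp add: P_def)
  next
    fix w and \<gamma>s :: "'c \<Rightarrow> 'b" assume "\<And>v. (v, w) \<in> R \<Longrightarrow> P \<gamma>s v (\<gamma>s v)"
    then show "\<exists>\<gamma>. P \<gamma>s w \<gamma>" using bound[of w \<gamma>s] unfolding P_def by blast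
  qed
  then show thesis using that unfolding P_def by blast
qed

section \<open>The Buttress Lemma\<close>

text \<open>By lower smallness the objects chosen strictly below \<open>u\<close> form a small
  family. \<open>LSb\<close> with \<open>\<psi> = \<rho> u\<close> bounds it by a monic object whose
  composite with \<open>\<rho> u\<close> is a double arrow.\<close>

lemma buttress_of_well_founded:
  fixes le :: "'u rel"
  assumes "Card_order lam" and "category B" and po: "poset U le" and "lower_small lam U le"
    and \<rho>: "\<And>u. u \<in> U \<Longrightarrow> \<rho> u \<in> Hom Sd (Fo b) (T u)"
    and LS: "LSb lam Bd B Sd S Fo Fa U T b"
    and "well_founded_poset U le"
  shows "\<exists>\<beta> \<tau>. buttress Bd B Sd S Fa U le b \<rho> \<beta> \<tau>"
proof -
  \<comment> \<open>The recursion runs along the strict order, because \<open>le\<close> is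
    reflexive on \<open>U\<close>.\<close>
  define R where "R = {(v, u). (v, u) \<in> le \<and> v \<noteq> u}"
  note le = posetD[OF po]
  have "wf R"
    unfolding wf_eq_minimal
  proof (intro allI impI)
    fix Q :: "'u set" and x assume x: "x \<in> Q"
    show "\<exists>z \<in> Q. \<forall>y. (y, z) \<in> R \<longrightarrow> y \<notin> Q"
    \<comment> \<open>\<open>wf\<close> tests subsets of the whole type, whereas minimal elements
      are given only for nonempty subsets of \<open>U\<close>. A member of \<open>Q\<close> outside
      \<open>U\<close> is never below anything, since \<open>le\<close> relates elements of
      \<open>U\<close> only.\<close>
    proof (cases "Q \<inter> U = {}")
      case True
      then have "(y, x) \<notin> R" if "y \<in> Q" for y using le(4)[of y x] that by (auto simp: R_def)
      then show ?thesis using x by blast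
    next
      case False
      have "\<forall>X \<subseteq> U. X \<noteq> {} \<longrightarrow> (\<exists>m \<in> X. \<forall>x \<in> X. (x, m) \<in> le \<longrightarrow> x = m)"
        using assms(7) by (simp add: well_founded_poset_def)
      from this[rule_format, OF Int_lower2 False]
      obtain m where "m \<in> Q \<inter> U" "\<forall>x \<in> Q \<inter> U. (x, m) \<in> le \<longrightarrow> x = m" by blast
      then have "(y, m) \<notin> R" if "y \<in> Q" for y using le(4)[of y m] that by (auto simp: R_def)
      then show ?thesis using \<open>m \<in> Q \<inter> U\<close> by blast
    qed
  qed
  then obtain \<gamma> where mon: "\<And>u. u \<in> U \<Longrightarrow> monic_object Bd B b (\<gamma> u)"
    and Q: "\<And>u. u \<in> U \<Longrightarrow> \<rho> u \<cdot>\<^bsub>S\<^esub> Fa (\<gamma> u) \<in> Ar Sd"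
    and inc: "\<And>v u. v \<in> U \<Longrightarrow> u \<in> U \<Longrightarrow> (v, u) \<in> R \<Longrightarrow> trianglelefteq Bd B b (\<gamma> v) (\<gamma> u)"
  proof (rule wf_increasing_monic_objects)
    fix u \<gamma>s assume u: "u \<in> U"
      and ms: "\<And>v. v \<in> U \<Longrightarrow> (v, u) \<in> R \<Longrightarrow> monic_object Bd B b (\<gamma>s v)"
    let ?I = "{v \<in> U. (v, u) \<in> R}"
    have "small lam {v \<in> U. (v, u) \<in> le}" using assms(4) u by (simp add: lower_small_def)
    then have I: "small lam ?I" by (rule small_subset) (auto simp: R_def)
    have "monic_object Bd B b (\<gamma>s v)" if "v \<in> ?I" for v using that ms by blast
    from LSb_family[OF LS assms(1) u \<rho>[OF u] I, of \<gamma>s, OF this]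
    obtain \<gamma> where "monic_object Bd B b \<gamma>" "\<rho> u \<cdot>\<^bsub>S\<^esub> Fa \<gamma> \<in> Ar Sd"
      "\<And>v. v \<in> ?I \<Longrightarrow> trianglelefteq Bd B b (\<gamma>s v) \<gamma>" by blast
    then show "\<exists>\<gamma>. monic_object Bd B b \<gamma> \<and> \<rho> u \<cdot>\<^bsub>S\<^esub> Fa \<gamma> \<in> Ar Sd \<and>
        (\<forall>v \<in> U. (v, u) \<in> R \<longrightarrow> trianglelefteq Bd B b (\<gamma>s v) \<gamma>)" by blast
  qed blast
  have "trianglelefteq Bd B b (\<gamma> v) (\<gamma> u)" if "(v, u) \<in> le" "v \<noteq> u" for u v
    using inc that le(4,5) by (simp add: R_def)
  from increasing_monic_objects_diagram[OF \<open>category B\<close> po, of Bd b \<gamma>, OF mon this]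
  obtain \<tau> where "diagram U le (comma Bd B b) \<gamma> \<tau>" by blast
  then show ?thesis using Q unfolding buttress_def by blast
qed

text \<open>\<open>LSb\<close> handles a single double arrow at a time; this suffices because a finite set has at most
  one greatest element. A set without one only needs an upper bound, given by \<open>LSb\<close> at any \<open>u\<close>.\<close>

lemma monic_objects_on_Fpow:
  assumes "Card_order lam" and "infinite (Field lam)" and po: "poset U le"
    and \<rho>: "\<And>u. u \<in> U \<Longrightarrow> \<rho> u \<in> Hom Sd (Fo b) (T u)"
    and LS: "LSb lam Bd B Sd S Fo Fa U T b"
  obtains \<gamma> where "\<And>a. a \<in> Fpow U \<Longrightarrow> monic_object Bd B b (\<gamma> a)"
    and "\<And>a a'. a' \<in> Fpow U \<Longrightarrow> a \<subset> a' \<Longrightarrow> trianglelefteq Bd B b (\<gamma> a) (\<gamma> a')"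
    and "\<And>a u. a \<in> Fpow U \<Longrightarrow> u \<in> a \<Longrightarrow> (\<forall>v \<in> a. (v, u) \<in> le) \<Longrightarrow> \<rho> u \<cdot>\<^bsub>S\<^esub> Fa (\<gamma> a) \<in> Ar Sd"
proof -
  let ?Q = "\<lambda>a \<gamma>. \<forall>u \<in> a. (\<forall>v \<in> a. (v, u) \<in> le) \<longrightarrow> \<rho> u \<cdot>\<^bsub>S\<^esub> Fa \<gamma> \<in> Ar Sd"
  obtain \<gamma> where mon: "\<And>a. a \<in> Fpow U \<Longrightarrow> monic_object Bd B b (\<gamma> a)"
    and Q: "\<And>a. a \<in> Fpow U \<Longrightarrow> ?Q a (\<gamma> a)"
    and inc: "\<And>a a'. a \<in> Fpow U \<Longrightarrow> a' \<in> Fpow U \<Longrightarrow> (a, a') \<in> finite_psubset \<Longrightarrow>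
      trianglelefteq Bd B b (\<gamma> a) (\<gamma> a')"
  proof (rule wf_increasing_monic_objects[OF wf_finite_psubset])
    fix a \<gamma>s assume a: "a \<in> Fpow U"
      and ms: "\<And>a'. a' \<in> Fpow U \<Longrightarrow> (a', a) \<in> finite_psubset \<Longrightarrow> monic_object Bd B b (\<gamma>s a')"
    let ?I = "{a' \<in> Fpow U. (a', a) \<in> finite_psubset}"
    \<comment> \<open>The predecessors of \<open>a\<close> are proper subsets of a finite set, hence
      finite in number, and small since \<open>lam\<close> is infinite.\<close>
    have "?I \<subseteq> Pow a" by (auto simp: finite_psubset_def)
    then have I: "small lam ?I"
      using a small_finite[OF assms(1,2)] finite_subset[of ?I "Pow a"] by (simp add: Fpow_def)
    obtain u where u: "u \<in> U" and "\<And>v. v \<in> a \<Longrightarrow> (\<forall>w \<in> a. (w, v) \<in> le) \<Longrightarrow> v = u"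
    proof (cases "\<exists>v \<in> a. \<forall>w \<in> a. (w, v) \<in> le")
      case True
      then show thesis using that a posetD(3)[OF po] unfolding Fpow_def by blast
    next
      case False
      obtain u where "u \<in> U" using po by (auto simp: poset_def)
      then show thesis using that False by blast
    qed
    then have Qu: "?Q a \<gamma>" if "\<rho> u \<cdot>\<^bsub>S\<^esub> Fa \<gamma> \<in> Ar Sd" for \<gamma> using that by blast
    have "monic_object Bd B b (\<gamma>s a')" if "a' \<in> ?I" for a' using that ms by blast
    from LSb_family[OF LS assms(1) u \<rho>[OF u] I, of \<gamma>s, OF this]
    obtain \<gamma> where "monic_object Bd B b \<gamma>" "\<rho> u \<cdot>\<^bsub>S\<^esub> Fa \<gamma> \<in> Ar Sd"
      "\<And>a'. a' \<in> ?I \<Longrightarrow> trianglelefteq Bd B b (\<gamma>s a') \<gamma>" by blast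
    then show "\<exists>\<gamma>. monic_object Bd B b \<gamma> \<and> ?Q a \<gamma> \<and>
        (\<forall>a' \<in> Fpow U. (a', a) \<in> finite_psubset \<longrightarrow> trianglelefteq Bd B b (\<gamma>s a') \<gamma>)"
      using Qu by blast
  qed blast
  show thesis
  proof
    fix a a' assume "a' \<in> Fpow U" "a \<subset> a'"
    moreover from this have "a \<in> Fpow U" "finite a'" by (auto simp: Fpow_def finite_subset)
    ultimately show "trianglelefteq Bd B b (\<gamma> a) (\<gamma> a')"
      using inc by (simp add: finite_psubset_def)
  qed (use mon Q in auto)
qed

text \<open>On each colimit leg, \<open>\<rho> u\<close> after the image of \<open>\<beta> u\<close>
  restricts to \<open>\<rho> u\<close> after the image of \<open>\<gamma> a\<close>, a double arrow
  because \<open>u\<close> is greatest in \<open>a\<close>; preservation and right closure then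
  yield the double arrow for \<open>\<beta> u\<close>. The \<open>\<beta> u\<close> are not claimed
  to be monic, so the diagram laws have to be checked on the colimit legs.\<close>

lemma buttress_of_directed_colimits:
  fixes lam :: "'k rel" and le :: "'u rel"
  assumes "Card_order lam" and "infinite (Field lam)"
    and "category B" and "category S"
    and full: "full_subcategory Bd B" and subS: "subcategory Sd S"
    and F: "cat_functor B S Fo Fa"
    and po: "poset U le" and lower: "lower_small lam U le" and bB: "b \<in> Ob B"
    and \<rho>: "\<And>u. u \<in> U \<Longrightarrow> \<rho> u \<in> Hom Sd (Fo b) (T u)"
    and LS: "LSb lam Bd B Sd S Fo Fa U T b"
    and has: "has_small_directed_colimits_in lam Bd B"
    and closed: "right_closed_small_directed_colimits lam Sd S"
    and pres: "preserves_small_directed_colimits lam B S Fo Fa"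
  shows "\<exists>\<beta> \<tau>. buttress Bd B Sd S Fa U le b \<rho> \<beta> \<tau>"
proof -
  interpret B: category B by fact
  interpret S: category S by fact
  interpret F: cat_functor B S Fo Fa by fact
  note le = posetD[OF po]
  have sub: "subcategory Bd B" using full by (simp add: full_subcategory_def)

  \<comment> \<open>The diagram of monic objects over the finite subsets of \<open>U\<close>\<close>
  obtain \<gamma> where mon: "\<And>a. a \<in> Fpow U \<Longrightarrow> monic_object Bd B b (\<gamma> a)"
    and inc: "\<And>a a'. a' \<in> Fpow U \<Longrightarrow> a \<subset> a' \<Longrightarrow> trianglelefteq Bd B b (\<gamma> a) (\<gamma> a')"
    and dbl: "\<And>a u. a \<in> Fpow U \<Longrightarrow> u \<in> a \<Longrightarrow> (\<forall>v \<in> a. (v, u) \<in> le) \<Longrightarrow>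
      \<rho> u \<cdot>\<^bsub>S\<^esub> Fa (\<gamma> a) \<in> Ar Sd"
    using monic_objects_on_Fpow[OF assms(1,2) po \<rho> LS] by blast
  define E :: "'u set rel" where "E = {(a, a'). a \<in> Fpow U \<and> a' \<in> Fpow U \<and> a \<subseteq> a'}"
  have poE: "poset (Fpow U) E"
    by (auto simp: poset_def partial_order_on_def preorder_on_def refl_on_def trans_def
        antisym_def E_def Fpow_not_empty)
  have "trianglelefteq Bd B b (\<gamma> a) (\<gamma> a')" if "(a, a') \<in> E" "a \<noteq> a'" for a a'
    using inc that unfolding E_def by blast
  from increasing_monic_objects_diagram[OF \<open>category B\<close> poE, of Bd b \<gamma>, OF mon this]
  obtain \<tau>0 where \<tau>0: "diagram (Fpow U) E (comma Bd B b) \<gamma> \<tau>0" by blast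
  \<comment> \<open>Passing from the comma category to \<open>B\<close>: \<open>X a\<close> is the
    underlying object, and \<open>t a a'\<close> is the middle component of the triple
    \<open>\<tau>0 a a'\<close>.\<close>
  define X where "X a = Dom B (\<gamma> a)" for a
  define t where "t a a' = fst (snd (\<tau>0 a a'))" for a a'
  have \<gamma>: "\<gamma> a \<in> Hom B (X a) b" "X a \<in> Ob Bd" if "a \<in> Fpow U" for a
    using mon[OF that] by (auto simp: monic_object_def comma_def Hom_def X_def)
  have \<tau>0_eq: "\<tau>0 a a' = (\<gamma> a, t a a', \<gamma> a')"
    and tH: "t a a' \<in> Hom B (X a) (X a')" and \<gamma>t: "\<gamma> a' \<cdot>\<^bsub>B\<^esub> t a a' = \<gamma> a"
    if "(a, a') \<in> E" for a a'
  proof -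
    have "\<tau>0 a a' \<in> Hom (comma Bd B b) (\<gamma> a) (\<gamma> a')"
      using that \<tau>0 by (simp add: diagram_def)
    then show "\<tau>0 a a' = (\<gamma> a, t a a', \<gamma> a')" "t a a' \<in> Hom B (X a) (X a')"
      "\<gamma> a' \<cdot>\<^bsub>B\<^esub> t a a' = \<gamma> a"
      by (auto simp: Hom_comma_iff t_def X_def)
  qed
  have tid: "t a a = Idt B (X a)" if "a \<in> Fpow U" for a
    using that \<tau>0 by (simp add: diagram_def t_def comma_def X_def)
  have tcmp: "t a' a'' \<cdot>\<^bsub>B\<^esub> t a a' = t a a''" if "(a, a') \<in> E" "(a', a'') \<in> E" for a a' a''
  proof -
    have "(a, a'') \<in> E" using that by (auto simp: E_def)
    moreover have "\<tau>0 a' a'' \<cdot>\<^bsub>comma Bd B b\<^esub> \<tau>0 a a' = \<tau>0 a a''"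
      using that \<tau>0 unfolding diagram_def by blast
    ultimately show ?thesis using that by (simp add: \<tau>0_eq comma_def)
  qed

  \<comment> \<open>The directed posets \<open>N u\<close> of finite subsets of \<open>U\<close>
    with greatest element \<open>u\<close>\<close>
  define N where "N u = insert u ` Fpow {v \<in> U. (v, u) \<in> le}" for u
  define Eu where "Eu u = {(a, a') \<in> E. a \<in> N u \<and> a' \<in> N u}" for u
  have NF: "a \<in> Fpow U" "u \<in> a" "\<forall>v \<in> a. (v, u) \<in> le" if "u \<in> U" "a \<in> N u" for a u
    using that le(1)[OF that(1)] by (auto simp: N_def Fpow_def)
  \<comment> \<open>Everything in \<open>a\<close> is below \<open>u\<close>, hence below
    \<open>v\<close>, so adding \<open>v\<close> makes it the greatest element.\<close>
  have NI: "insert v a \<in> N v" if "(u, v) \<in> le" "a \<in> N u" for u v a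
  proof -
    have "finite a" "a \<subseteq> U" "\<forall>x \<in> a. (x, u) \<in> le"
      using NF[OF le(4)[OF that(1)] that(2)] by (auto simp: Fpow_def)
    then have "a \<in> Fpow {x \<in> U. (x, v) \<in> le}"
      using le(2)[OF _ that(1)] by (auto simp: Fpow_def)
    then show ?thesis unfolding N_def by (rule imageI)
  qed
  have Ninsert: "insert u a = a" if "u \<in> U" "a \<in> N u" for u a
    using NF[OF that] by blast
  have Eu_sub: "Eu u \<subseteq> N u \<times> N u" "Eu u \<subseteq> E" for u by (auto simp: Eu_def)
  have dirN: "directed_poset (N u) (Eu u)" if "u \<in> U" for u
  proof -
    have "poset (N u) (Eu u)"
      unfolding poset_def partial_order_on_def preorder_on_def
    proof (intro conjI)
      show "N u \<noteq> {}" by (simp add: N_def Fpow_not_empty)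
      show "Eu u \<subseteq> N u \<times> N u" by (rule Eu_sub)
      show "refl_on (N u) (Eu u)"
        using NF(1)[OF that] by (simp add: refl_on_def Eu_def E_def)
      show "trans (Eu u)" by (rule transI) (auto simp: Eu_def E_def)
      show "antisym (Eu u)" by (rule antisymI) (auto simp: Eu_def E_def)
    qed
    moreover have "\<exists>c \<in> N u. (a, c) \<in> Eu u \<and> (a', c) \<in> Eu u" if a: "a \<in> N u" and a': "a' \<in> N u" for a a'
    proof
      obtain x where x: "a = insert u x" "x \<in> Fpow {v \<in> U. (v, u) \<in> le}"
        using a unfolding N_def by (elim imageE)
      obtain y where y: "a' = insert u y" "y \<in> Fpow {v \<in> U. (v, u) \<in> le}"
        using a' unfolding N_def by (elim imageE)
      \<comment> \<open>The union of \<open>insert u x\<close> and \<open>insert u y\<close> is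
        \<open>insert u (x \<union> y)\<close>, so \<open>N u\<close> is closed under binary unions,
        which are the upper bounds sought.\<close>
      have "insert u (x \<union> y) \<in> N u"
        using x(2) y(2) unfolding N_def by (intro imageI) (auto simp: Fpow_def)
      then show "a \<union> a' \<in> N u" by (simp add: x(1) y(1))
      then show "(a, a \<union> a') \<in> Eu u \<and> (a', a \<union> a') \<in> Eu u"
        using a a' NF(1)[OF \<open>u \<in> U\<close>] by (simp add: Eu_def E_def)
    qed
    ultimately show ?thesis by (simp add: directed_poset_def)
  qed
  \<comment> \<open>Here it matters that \<open>N u\<close> is an image of the finite subsets of the
    lower set of \<open>u\<close>.\<close>
  have smallN: "small lam (N u)" if "u \<in> U" for u
    unfolding N_def using lower that
    by (intro small_image small_Fpow[OF assms(1,2)]) (simp add: lower_small_def)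
  have diaB: "diagram (N u) (Eu u) B X t" if u: "u \<in> U" for u
    unfolding diagram_def
  proof (intro conjI ballI allI impI)
    show "X a \<in> Ob B" "t a a = Idt B (X a)" if "a \<in> N u" for a
      using that \<gamma>(2) NF(1)[OF u] tid sub by (auto simp: subcategory_def)
  qed (use tH tcmp Eu_sub(2) in blast)+
  \<comment> \<open>Existence of colimits is assumed for diagrams in \<open>Bd\<close>, while the
    colimits live in \<open>B\<close>. The same data are therefore a diagram in both; fullness
    places the arrows in \<open>Bd\<close>.\<close>
  have diaBd: "diagram (N u) (Eu u) Bd X t" if u: "u \<in> U" for u
    unfolding diagram_def
  proof (intro conjI ballI allI impI)
    have Hd: "t a a' \<in> Hom Bd (X a) (X a')" if "(a, a') \<in> Eu u" for a a'
    proof -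
      have "t a a' \<in> Hom B (X a) (X a')" "X a \<in> Ob Bd" "X a' \<in> Ob Bd"
        using that tH \<gamma>(2) NF(1)[OF u] by (auto simp: Eu_def)
      then show ?thesis using full_subcategory_Hom[OF full] by blast
    qed
    then show "t a a' \<in> Hom Bd (X a) (X a')" if "(a, a') \<in> Eu u" for a a' using that .
    show "t a' a'' \<cdot>\<^bsub>Bd\<^esub> t a a' = t a a''" if "(a, a') \<in> Eu u" "(a', a'') \<in> Eu u" for a a' a''
    proof -
      have "t a' a'' \<cdot>\<^bsub>Bd\<^esub> t a a' = t a' a'' \<cdot>\<^bsub>B\<^esub> t a a'"
        using Hd[OF that(1)] Hd[OF that(2)] sub by (simp add: subcategory_def Hom_def)
      also have "\<dots> = t a a''" using tcmp that Eu_sub(2) by blast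
      finally show ?thesis .
    qed
    show "X a \<in> Ob Bd" "t a a = Idt Bd (X a)" if "a \<in> N u" for a
      using that \<gamma>(2) NF(1)[OF u] tid sub by (auto simp: subcategory_def)
  qed

  \<comment> \<open>The colimits over \<open>N u\<close> and their arrows to
    \<open>b\<close>\<close>
  have "\<exists>c s. colimit_cocone (N u) (Eu u) B X t c s \<and> c \<in> Ob Bd" if "u \<in> U" for u
    using has_small_directed_colimits_inD[OF has assms(1) dirN smallN diaBd] that by blast
  then obtain c s where colim: "\<And>u. u \<in> U \<Longrightarrow> colimit_cocone (N u) (Eu u) B X t (c u) (s u)"
    and cBd: "\<And>u. u \<in> U \<Longrightarrow> c u \<in> Ob Bd"
    by metis
  have cB: "c u \<in> Ob B" if "u \<in> U" for u
    using that cBd sub by (auto simp: subcategory_def)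
  have sH: "s u a \<in> Hom B (X a) (c u)" if "u \<in> U" "a \<in> N u" for u a
    using colim that by (simp add: colimit_cocone_def cocone_def)
  have st: "s u a' \<cdot>\<^bsub>B\<^esub> t a a' = s u a" if "u \<in> U" "(a, a') \<in> Eu u" for u a a'
    using colim that by (simp add: colimit_cocone_def cocone_def)
  note cancel = B.colimit_cocone_cancel[OF colim diaB Eu_sub(1)]

  \<comment> \<open>By \<open>\<gamma>t\<close> the monic objects themselves form a cocone with apex
    \<open>b\<close>; \<open>\<beta> u\<close> is the arrow it induces on the colimit.\<close>
  have "\<exists>g. g \<in> Hom B (c u) b \<and> (\<forall>a \<in> N u. g \<cdot>\<^bsub>B\<^esub> s u a = \<gamma> a)" if u: "u \<in> U" for u
  proof -
    have "cocone (N u) (Eu u) B X t b \<gamma>"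
      using bB \<gamma>(1) NF(1)[OF u] \<gamma>t[OF subsetD[OF Eu_sub(2)]] by (auto simp: cocone_def)
    then show ?thesis using colim[OF u] unfolding colimit_cocone_def by blast
  qed
  then obtain \<beta> where \<beta>: "\<And>u. u \<in> U \<Longrightarrow> \<beta> u \<in> Hom B (c u) b"
    and \<beta>s: "\<And>u a. u \<in> U \<Longrightarrow> a \<in> N u \<Longrightarrow> \<beta> u \<cdot>\<^bsub>B\<^esub> s u a = \<gamma> a"
    by metis

  \<comment> \<open>Transition arrows between the colimits\<close>
  have Ein: "(a, insert v a) \<in> E" if "(u, v) \<in> le" "a \<in> N u" for u v a
    using that NF(1)[OF le(4)[OF that(1)] that(2)] le(5)[OF that(1)] by (auto simp: E_def Fpow_def)
  have Emono: "(insert v a, insert v a') \<in> Eu v" if uv: "(u, v) \<in> le" and aa: "(a, a') \<in> Eu u" for u v a a'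
    using NI[OF uv] NF(1)[OF le(5)[OF uv]] aa by (auto simp: Eu_def E_def)
  \<comment> \<open>The index \<open>a\<close> is enlarged to \<open>insert v a\<close>, which lies
    in \<open>N v\<close>, and then sent into the colimit \<open>c v\<close>; these composites form
    a cocone.\<close>
  have "\<exists>h. h \<in> Hom B (c u) (c v) \<and>
      (\<forall>a \<in> N u. h \<cdot>\<^bsub>B\<^esub> s u a = s v (insert v a) \<cdot>\<^bsub>B\<^esub> t a (insert v a))" if uv: "(u, v) \<in> le" for u v
  proof -
    have u: "u \<in> U" and v: "v \<in> U" using uv le by blast+
    have "cocone (N u) (Eu u) B X t (c v) (\<lambda>a. s v (insert v a) \<cdot>\<^bsub>B\<^esub> t a (insert v a))"
      unfolding cocone_def
    proof (intro conjI ballI allI impI)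
      fix a assume a: "a \<in> N u"
      show "s v (insert v a) \<cdot>\<^bsub>B\<^esub> t a (insert v a) \<in> Hom B (X a) (c v)"
        using B.Cmp_closed[OF tH[OF Ein[OF uv a]] sH[OF v NI[OF uv a]]] .
    next
      fix a a' assume aa: "(a, a') \<in> Eu u"
      then have a: "a \<in> N u" and a': "a' \<in> N u" and E: "(a, a') \<in> E" by (auto simp: Eu_def)
      have mono: "(insert v a, insert v a') \<in> Eu v" by (rule Emono[OF uv aa])
      then have E': "(insert v a, insert v a') \<in> E" by (simp add: Eu_def)
      \<comment> \<open>Both routes from \<open>X a\<close> pass to \<open>X (insert v a')\<close>:
        one through \<open>a'\<close>, the other through \<open>insert v a\<close>. They agree by
        functoriality of \<open>t\<close>, and the last leg drops to \<open>insert v a\<close>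
        because that inclusion lies in \<open>Eu v\<close>.\<close>
      have "(s v (insert v a') \<cdot>\<^bsub>B\<^esub> t a' (insert v a')) \<cdot>\<^bsub>B\<^esub> t a a'
          = s v (insert v a') \<cdot>\<^bsub>B\<^esub> t a (insert v a')"
        using B.Cmp_assoc[OF tH[OF E] tH[OF Ein[OF uv a']] sH[OF v NI[OF uv a']]]
          tcmp[OF E Ein[OF uv a']] by simp
      also have "\<dots> = s v (insert v a') \<cdot>\<^bsub>B\<^esub> (t (insert v a) (insert v a') \<cdot>\<^bsub>B\<^esub> t a (insert v a))"
        using tcmp[OF Ein[OF uv a] E'] by simp
      also have "\<dots> = s v (insert v a) \<cdot>\<^bsub>B\<^esub> t a (insert v a)"
        using B.Cmp_assoc[OF tH[OF Ein[OF uv a]] tH[OF E'] sH[OF v NI[OF uv a']]]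
          st[OF v mono] by simp
      finally show "(s v (insert v a') \<cdot>\<^bsub>B\<^esub> t a' (insert v a')) \<cdot>\<^bsub>B\<^esub> t a a'
          = s v (insert v a) \<cdot>\<^bsub>B\<^esub> t a (insert v a)" .
    qed (rule cB[OF v])
    then show ?thesis using colim[OF u] unfolding colimit_cocone_def by blast
  qed
  then obtain h where hH: "\<And>u v. (u, v) \<in> le \<Longrightarrow> h u v \<in> Hom B (c u) (c v)"
    and hs: "\<And>u v a. (u, v) \<in> le \<Longrightarrow> a \<in> N u \<Longrightarrow>
      h u v \<cdot>\<^bsub>B\<^esub> s u a = s v (insert v a) \<cdot>\<^bsub>B\<^esub> t a (insert v a)"
    by metis

  \<comment> \<open>Compatibility with \<open>\<beta>\<close> and the diagram laws\<close>
  have \<beta>h: "\<beta> v \<cdot>\<^bsub>B\<^esub> h u v = \<beta> u" if uv: "(u, v) \<in> le" for u v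
  proof -
    have u: "u \<in> U" and v: "v \<in> U" using uv le by blast+
    show ?thesis
    proof (rule cancel[OF u u B.Cmp_closed[OF hH[OF uv] \<beta>[OF v]] \<beta>[OF u]])
      fix a assume a: "a \<in> N u"
      have "(\<beta> v \<cdot>\<^bsub>B\<^esub> h u v) \<cdot>\<^bsub>B\<^esub> s u a
          = \<beta> v \<cdot>\<^bsub>B\<^esub> (s v (insert v a) \<cdot>\<^bsub>B\<^esub> t a (insert v a))"
        using B.Cmp_assoc[OF sH[OF u a] hH[OF uv] \<beta>[OF v]] hs[OF uv a] by simp
      also have "\<dots> = \<gamma> (insert v a) \<cdot>\<^bsub>B\<^esub> t a (insert v a)"
        using B.Cmp_assoc[OF tH[OF Ein[OF uv a]] sH[OF v NI[OF uv a]] \<beta>[OF v]]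
          \<beta>s[OF v NI[OF uv a]] by simp
      also have "\<dots> = \<beta> u \<cdot>\<^bsub>B\<^esub> s u a" using \<gamma>t[OF Ein[OF uv a]] \<beta>s[OF u a] by simp
      finally show "(\<beta> v \<cdot>\<^bsub>B\<^esub> h u v) \<cdot>\<^bsub>B\<^esub> s u a = \<beta> u \<cdot>\<^bsub>B\<^esub> s u a" .
    qed
  qed
  have hid: "h u u = Idt B (c u)" if u: "u \<in> U" for u
  proof (rule cancel[OF u u hH[OF le(1)[OF u]] B.Idt_closed[OF cB[OF u]]])
    fix a assume a: "a \<in> N u"
    \<comment> \<open>For \<open>v = u\<close> the enlargement changes nothing:
      \<open>insert u a = a\<close>, and the arrow of \<open>t\<close> involved is an
      identity.\<close>
    have "h u u \<cdot>\<^bsub>B\<^esub> s u a = s u a \<cdot>\<^bsub>B\<^esub> Idt B (X a)"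
      using hs[OF le(1)[OF u] a] Ninsert[OF u a] tid[OF NF(1)[OF u a]] by simp
    then show "h u u \<cdot>\<^bsub>B\<^esub> s u a = Idt B (c u) \<cdot>\<^bsub>B\<^esub> s u a"
      using B.Cmp_Idt[OF sH[OF u a]] B.Idt_Cmp[OF sH[OF u a]] by simp
  qed
  have hcmp: "h v w \<cdot>\<^bsub>B\<^esub> h u v = h u w" if uv: "(u, v) \<in> le" and vw: "(v, w) \<in> le" for u v w
  proof -
    have u: "u \<in> U" and v: "v \<in> U" and w: "w \<in> U" and uw: "(u, w) \<in> le"
      using uv vw le by blast+
    show ?thesis
    proof (rule cancel[OF u u B.Cmp_closed[OF hH[OF uv] hH[OF vw]] hH[OF uw]])
      fix a assume a: "a \<in> N u"
      \<comment> \<open>The composite goes through \<open>?vw\<close>, while \<open>h u w\<close>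
        goes through \<open>?w\<close>; these sets may differ. Both lie in \<open>N w\<close> and
        \<open>?w\<close> is contained in \<open>?vw\<close>, so the cocone condition at
        \<open>w\<close> identifies the two.\<close>
      let ?v = "insert v a" and ?w = "insert w a" and ?vw = "insert w (insert v a)"
      have v': "?v \<in> N v" and w': "?w \<in> N w" and vw': "?vw \<in> N w"
        using NI a uv uw vw by blast+
      have E1: "(a, ?v) \<in> E" "(a, ?w) \<in> E" "(?v, ?vw) \<in> E" "(?w, ?vw) \<in> E"
        using NF(1)[OF u a] NF(1)[OF v v'] NF(1)[OF w w'] NF(1)[OF w vw'] by (auto simp: E_def)
      have E2: "(?w, ?vw) \<in> Eu w" using E1(4) w' vw' by (simp add: Eu_def)
      have "(h v w \<cdot>\<^bsub>B\<^esub> h u v) \<cdot>\<^bsub>B\<^esub> s u a = h v w \<cdot>\<^bsub>B\<^esub> (s v ?v \<cdot>\<^bsub>B\<^esub> t a ?v)"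
        using B.Cmp_assoc[OF sH[OF u a] hH[OF uv] hH[OF vw]] hs[OF uv a] by simp
      also have "\<dots> = (s w ?vw \<cdot>\<^bsub>B\<^esub> t ?v ?vw) \<cdot>\<^bsub>B\<^esub> t a ?v"
        using B.Cmp_assoc[OF tH[OF E1(1)] sH[OF v v'] hH[OF vw]] hs[OF vw v'] by simp
      also have "\<dots> = s w ?vw \<cdot>\<^bsub>B\<^esub> t a ?vw"
        using B.Cmp_assoc[OF tH[OF E1(1)] tH[OF E1(3)] sH[OF w vw']] tcmp[OF E1(1,3)] by simp
      also have "\<dots> = (s w ?vw \<cdot>\<^bsub>B\<^esub> t ?w ?vw) \<cdot>\<^bsub>B\<^esub> t a ?w"
        using B.Cmp_assoc[OF tH[OF E1(2)] tH[OF E1(4)] sH[OF w vw']] tcmp[OF E1(2,4)] by simp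
      also have "\<dots> = h u w \<cdot>\<^bsub>B\<^esub> s u a" using st[OF w E2] hs[OF uw a] by simp
      finally show "(h v w \<cdot>\<^bsub>B\<^esub> h u v) \<cdot>\<^bsub>B\<^esub> s u a = h u w \<cdot>\<^bsub>B\<^esub> s u a" .
    qed
  qed

  have \<beta>_ob: "\<beta> u \<in> Ob (comma Bd B b)" and \<beta>_dom: "Dom B (\<beta> u) = c u" if "u \<in> U" for u
    using \<beta>[OF that] cBd[OF that] by (auto simp: comma_def Hom_def)
  have "diagram U le (comma Bd B b) \<beta> (\<lambda>u v. (\<beta> u, h u v, \<beta> v))"
    unfolding diagram_def
  proof (intro conjI ballI allI impI)
    fix u v assume uv: "(u, v) \<in> le"
    then have "u \<in> U" "v \<in> U" using le by blast+
    then show "(\<beta> u, h u v, \<beta> v) \<in> Hom (comma Bd B b) (\<beta> u) (\<beta> v)"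
      using \<beta>_ob \<beta>_dom hH[OF uv] \<beta>h[OF uv] by (simp add: Hom_comma_iff)
  qed (use \<beta>_ob \<beta>_dom hid hcmp in \<open>auto simp: comma_def\<close>)

  \<comment> \<open>The double arrow condition for \<open>\<beta> u\<close>\<close>
  moreover have "\<rho> u \<cdot>\<^bsub>S\<^esub> Fa (\<beta> u) \<in> Ar Sd" if u: "u \<in> U" for u
  proof -
    have \<rho>S: "\<rho> u \<in> Hom S (Fo b) (T u)" using \<rho>[OF u] subcategory_Hom[OF subS] by blast
    note F\<beta> = F.Fa_closed[OF \<beta>[OF u]]
    show ?thesis
    \<comment> \<open>Right closure is applied to the image under the functor of the colimit cocone
      defining \<open>c u\<close>, again a colimit cocone by preservation; the condition remains to
      be checked on its legs.\<close>
    proof (rule right_closed_small_directed_colimitsD[OF closed assms(1) dirN[OF u] smallN[OF u]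
          cat_functor_diagram[OF F Eu_sub(1) diaB[OF u]]
          preserves_small_directed_colimitsD[OF pres assms(1) dirN[OF u] smallN[OF u] diaB[OF u]
            colim[OF u]]
          S.Cmp_closed[OF F\<beta> \<rho>S]])
      fix a assume a: "a \<in> N u"
      have "(\<rho> u \<cdot>\<^bsub>S\<^esub> Fa (\<beta> u)) \<cdot>\<^bsub>S\<^esub> Fa (s u a) = \<rho> u \<cdot>\<^bsub>S\<^esub> Fa (\<gamma> a)"
        using S.Cmp_assoc[OF F.Fa_closed[OF sH[OF u a]] F\<beta> \<rho>S] F.Fa_Cmp[OF sH[OF u a] \<beta>[OF u]]
          \<beta>s[OF u a] by simp
      \<comment> \<open>\<open>NF\<close> says that \<open>u\<close> is the greatest element of
        \<open>a\<close>, exactly the situation in which \<open>dbl\<close> provides a double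
        arrow.\<close>
      then show "(\<rho> u \<cdot>\<^bsub>S\<^esub> Fa (\<beta> u)) \<cdot>\<^bsub>S\<^esub> Fa (s u a) \<in> Ar Sd"
        using dbl[OF NF[OF u a]] by simp
    qed
  qed
  ultimately show ?thesis unfolding buttress_def by blast
qed

theorem mainTheorem3:
  fixes lam :: "'k rel"
    and \<B>d \<B> :: "('o, 'a) category" and \<S>d \<S> :: "('p, 'b) category"
    and \<Psi>o :: "'o \<Rightarrow> 'p" and \<Psi>a :: "'a \<Rightarrow> 'b"
    and U :: "'u set" and le :: "'u rel"
    and B :: 'o and S :: "'u \<Rightarrow> 'p" and \<rho> :: "'u \<Rightarrow> 'b"
  assumes "Card_order lam" and "infinite (Field lam)"
    and "category \<B>" and "category \<S>"
    and "full_subcategory \<B>d \<B>" and "subcategory \<S>d \<S>"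
    and "cat_functor \<B> \<S> \<Psi>o \<Psi>a"
    and "poset U le" and "lower_small lam U le"
    and "B \<in> Ob \<B>"
    and "\<And>u. u \<in> U \<Longrightarrow> \<rho> u \<in> Hom \<S>d (\<Psi>o B) (S u)"
    and "LSb lam \<B>d \<B> \<S>d \<S> \<Psi>o \<Psi>a U S B"
    and "well_founded_poset U le \<or>
         (has_small_directed_colimits_in lam \<B>d \<B> \<and>
          right_closed_small_directed_colimits lam \<S>d \<S> \<and>
          preserves_small_directed_colimits lam \<B> \<S> \<Psi>o \<Psi>a)"
  shows "\<exists>\<beta> \<tau>. buttress \<B>d \<B> \<S>d \<S> \<Psi>a U le B \<rho> \<beta> \<tau>"
  using assms(13)
proof
  assume "well_founded_poset U le"
  with assms(1,3,8,9,11,12) show ?thesis by (intro buttress_of_well_founded)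
next
  assume "has_small_directed_colimits_in lam \<B>d \<B> \<and>
    right_closed_small_directed_colimits lam \<S>d \<S> \<and>
    preserves_small_directed_colimits lam \<B> \<S> \<Psi>o \<Psi>a"
  with assms(1-12) show ?thesis by (intro buttress_of_directed_colimits) auto
qed

end
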